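(* Let $\gamma,\alpha\in(0,1)$ and let $(\theta_i,Z_i)_{i\in[m]}$ follow the i.i.d. two-group model described in the context. Then ranking by the local false discovery rate (the ranking used by Procedure 1) is optimal in the following sense: for every decision rule $\boldsymbol\delta$ satisfying $$\mathbb{P}\left(\frac{\sum_{i=1}^m(1-\theta_i)\delta_i}{\max\{\sum_{i=1}^m\delta_i,1\}}>\gamma\right)\le\alpha,$$ there exists an lfdr-based thresholding rule $\boldsymbol\delta'$ that also satisfies $$\mathbb{P}\left(\frac{\sum_{i=1}^m(1-\theta_i)\delta'_i}{\max\{\sum_{i=1}^m\delta'_i,1\}}>\gamma\right)\le\alpha$$ and such that $$\mathbb{E}\left(\sum_{i=1}^m\theta_i\delta_i'\right)\ \ge\ \mathbb{E}\left(\sum_{i=1}^m\theta_i\delta_i\right).$$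
   Context: Two-group model: $[m]=\{1,\dots,m\}$; $\theta_1,\dots,\theta_m$ are i.i.d. Bernoulli$(\pi)$ with $\pi=\mathbb{P}(\theta_i=1)$ ($\theta_i=0$ means the $i$-th null hypothesis is true). Given $\boldsymbol\theta=(\theta_i)_{i\in[m]}$, the observations $Z_1,\dots,Z_m$ are independent, and $Z_i$ has density $f_0$ if $\theta_i=0$ and density $f_1$ if $\theta_i=1$. Let $f=(1-\pi)f_0+\pi f_1$ and $\boldsymbol Z=(Z_i)_{i\in[m]}$. The quantities $\pi,f_0,f$ are known. Local false discovery rate: $T_i^{OR}=\mathbb{P}(\theta_i=0\mid Z_i)=(1-\pi)f_0(Z_i)/f(Z_i)$. A decision rule is a vector $\boldsymbol\delta=(\delta_i)_{i\in[m]}\in\{0,1\}^m$ that is a measurable function of $\boldsymbol Z$, possibly together with an auxiliary randomization variable independent of $(\boldsymbol\theta,\boldsymbol Z)$; $\delta_i=1$ means that the $i$-th null is rejected. An lfdr-based thresholding rule is a decision rule that orders the hypotheses by increasing $T_i^{OR}$ (ties broken arbitrarily) and rejects the first $k$ of them, where $k\in\{0,1,\dots,m\}$ may depend on the data (and on the auxiliary randomization variable). The expected number of true positives (ETP), used as the measure of power, is $\mathbb{E}(\sum_i\theta_i\delta_i)$. *)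

theory Defs
  imports "HOL-Probability.Probability"
begin

definition mixture_density :: "real \<Rightarrow> ('z \<Rightarrow> real) \<Rightarrow> ('z \<Rightarrow> real) \<Rightarrow> 'z \<Rightarrow> real" where
  "mixture_density \<pi> f0 f1 z = (1 - \<pi>) * f0 z + \<pi> * f1 z"

text \<open>The quotient is \<open>0\<close> where the mixture density vanishes, which happens for
  \<open>Z i\<close> with probability zero.  Lemma \<open>lfdr_cond_prob\<close> below shows that \<open>lfdr\<close> at \<open>Z i\<close> is a
  version of the conditional probability of a true null given \<open>Z i\<close>.\<close>

definition lfdr :: "real \<Rightarrow> ('z \<Rightarrow> real) \<Rightarrow> ('z \<Rightarrow> real) \<Rightarrow> 'z \<Rightarrow> real" where
  "lfdr \<pi> f0 f1 z = (1 - \<pi>) * f0 z / mixture_density \<pi> f0 f1 z"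

text \<open>Hypotheses are indexed by \<open>{1..m}\<close>; \<open>\<theta> i \<omega>\<close> is \<open>False\<close> when the \<open>i\<close>-th null hypothesis is true.
  The densities are taken with respect to a \<open>\<sigma>\<close>-finite measure \<open>N\<close> on an arbitrary
  observation space.  Since the vector of states takes finitely many values, conditioning on it is
  elementary conditioning on the events of positive probability \<open>\<theta> = t\<close>, that is, passing
  to \<open>uniform_measure M {\<omega> \<in> space M. \<forall>i\<in>{1..m}. \<theta> i \<omega> = t i}\<close>.\<close>

locale two_group_model = prob_space M + base: sigma_finite_measure N
  for M :: "'w measure" and N :: "'z measure" +
  fixes m :: nat and \<pi> :: real and f0 f1 :: "'z \<Rightarrow> real"
    and \<theta> :: "nat \<Rightarrow> 'w \<Rightarrow> bool" and Z :: "nat \<Rightarrow> 'w \<Rightarrow> 'z"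
  assumes pi_range: "0 \<le> \<pi>" "\<pi> \<le> 1"
    and f0_measurable: "f0 \<in> borel_measurable N"
    and f1_measurable: "f1 \<in> borel_measurable N"
    and f0_nonneg: "\<And>z. z \<in> space N \<Longrightarrow> 0 \<le> f0 z"
    and f1_nonneg: "\<And>z. z \<in> space N \<Longrightarrow> 0 \<le> f1 z"
    and f0_prob: "prob_space (density N f0)"
    and f1_prob: "prob_space (density N f1)"
    and theta_indep: "indep_vars (\<lambda>_. count_space UNIV) \<theta> {1..m}"
    and theta_distr: "\<And>i. i \<in> {1..m} \<Longrightarrow>
      distr M (count_space UNIV) (\<theta> i) = measure_pmf (bernoulli_pmf \<pi>)"
    and Z_measurable: "\<And>i. i \<in> {1..m} \<Longrightarrow> random_variable N (Z i)"
    and Z_cond_indep: "\<And>t. prob {\<omega> \<in> space M. \<forall>i\<in>{1..m}. \<theta> i \<omega> = t i} > 0 \<Longrightarrow>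
      prob_space.indep_vars (uniform_measure M {\<omega> \<in> space M. \<forall>i\<in>{1..m}. \<theta> i \<omega> = t i})
        (\<lambda>_. N) Z {1..m}"
    and Z_cond_density: "\<And>t i. prob {\<omega> \<in> space M. \<forall>j\<in>{1..m}. \<theta> j \<omega> = t j} > 0 \<Longrightarrow>
      i \<in> {1..m} \<Longrightarrow>
      distributed (uniform_measure M {\<omega> \<in> space M. \<forall>j\<in>{1..m}. \<theta> j \<omega> = t j}) N (Z i)
        (if t i then f1 else f0)"

context two_group_model
begin

lemma theta_measurable:
  assumes "i \<in> {1..m}"
  shows "\<theta> i \<in> M \<rightarrow>\<^sub>M count_space UNIV"
  using theta_indep assms unfolding indep_vars_def by blast

lemma f_measurable:
  shows "(if b then f1 else f0) \<in> borel_measurable N"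
  using f0_measurable f1_measurable by simp

lemma prob_theta:
  assumes i: "i \<in> {1..m}"
  shows "prob {\<omega> \<in> space M. \<theta> i \<omega> = b} = (if b then \<pi> else 1 - \<pi>)"
proof -
  have "prob {\<omega> \<in> space M. \<theta> i \<omega> = b} = measure (distr M (count_space UNIV) (\<theta> i)) {b}"
    by (subst measure_distr[OF theta_measurable[OF i]]) (auto intro!: arg_cong[where f = prob])
  also have "\<dots> = (if b then \<pi> else 1 - \<pi>)"
    unfolding theta_distr[OF i] using pi_range by (simp add: measure_pmf_single)
  finally show ?thesis .
qed

lemma prob_theta_Z:
  assumes i: "i \<in> {1..m}" and B: "B \<in> sets N"
  shows "prob {\<omega> \<in> space M. \<theta> i \<omega> = b \<and> Z i \<omega> \<in> B} =
    (if b then \<pi> else 1 - \<pi>) * measure (density N (if b then f1 else f0)) B"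
proof -
  define T where "T = {t \<in> {1..m} \<rightarrow>\<^sub>E (UNIV :: bool set). t i = b}"
  define E where "E t = {\<omega> \<in> space M. \<forall>j\<in>{1..m}. \<theta> j \<omega> = t j}" for t
  define D where "D = {\<omega> \<in> space M. Z i \<omega> \<in> B}"
  have finT: "finite T"
    unfolding T_def by (rule finite_subset[OF _ finite_PiE[of "{1..m}" "\<lambda>_. UNIV :: bool set"]]) auto
  have E_eq: "E t = (\<Inter>j\<in>{1..m}. \<theta> j -` {t j} \<inter> space M) \<inter> space M" for t
    by (auto simp: E_def)
  have E_sets: "E t \<in> sets M" for t
  proof -
    have "{\<omega> \<in> space M. \<theta> j \<omega> = t j} \<in> sets M" if "j \<in> {1..m}" for j
    proof -
      have "{\<omega> \<in> space M. \<theta> j \<omega> = t j} = \<theta> j -` {t j} \<inter> space M" by auto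
      then show ?thesis using measurable_sets[OF theta_measurable[OF that], of "{t j}"] by simp
    qed
    then show ?thesis unfolding E_def by (intro sets.sets_Collect_finite_All) auto
  qed
  have D_eq: "D = Z i -` B \<inter> space M" by (auto simp: D_def)
  have D_sets: "D \<in> sets M"
    unfolding D_eq using Z_measurable[OF i] B by (rule measurable_sets)
  have disj: "disjoint_family_on E T"
    unfolding disjoint_family_on_def
  proof (intro ballI impI)
    fix s t assume "s \<in> T" "t \<in> T" "s \<noteq> t"
    then obtain j where "j \<in> {1..m}" "s j \<noteq> t j"
      using PiE_ext[of s "{1..m}" "\<lambda>_. UNIV" t] unfolding T_def by blast
    then show "E s \<inter> E t = {}" unfolding E_def by blast
  qed
  have E_union: "(\<Union>t\<in>T. E t) = {\<omega> \<in> space M. \<theta> i \<omega> = b}"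
  proof (intro equalityI subsetI)
    fix \<omega> assume "\<omega> \<in> {\<omega> \<in> space M. \<theta> i \<omega> = b}"
    then show "\<omega> \<in> (\<Union>t\<in>T. E t)"
      using i by (intro UN_I[of "\<lambda>j\<in>{1..m}. \<theta> j \<omega>"]) (auto simp: T_def E_def)
  qed (use i in \<open>auto simp: T_def E_def\<close>)
  have cond: "prob (E t \<inter> D) = prob (E t) * measure (density N (if b then f1 else f0)) B"
    if t: "t \<in> T" for t
  proof (cases "prob (E t) > 0")
    case True
    have "t i = b" using t by (simp add: T_def)
    have d: "distributed (uniform_measure M (E t)) N (Z i) (if t i then f1 else f0)"
      using Z_cond_density[of t i] True i unfolding E_def by blast
    have "measure (density N (if b then f1 else f0)) B =
        measure (distr (uniform_measure M (E t)) N (Z i)) B"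
      using d \<open>t i = b\<close> by (simp add: distributed_def)
    also have "\<dots> = measure (uniform_measure M (E t)) D"
      using measure_distr[OF _ B, of "Z i" "uniform_measure M (E t)"] d
      unfolding distributed_def by (simp add: D_eq)
    also have "\<dots> = prob (E t \<inter> D) / prob (E t)"
      using True E_sets D_sets by (intro measure_uniform_measure) (auto simp: emeasure_eq_measure)
    finally show ?thesis using True by simp
  next
    case False
    then have "prob (E t) = 0" using measure_nonneg[of M "E t"] by linarith
    moreover have "prob (E t \<inter> D) \<le> prob (E t)" using E_sets by (intro finite_measure_mono) auto
    ultimately show ?thesis using measure_nonneg[of M "E t \<inter> D"] by simp
  qed
  have "{\<omega> \<in> space M. \<theta> i \<omega> = b \<and> Z i \<omega> \<in> B} = (\<Union>t\<in>T. E t \<inter> D)"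
    using E_union by (auto simp: D_def)
  also have "prob \<dots> = (\<Sum>t\<in>T. prob (E t \<inter> D))"
    using finT E_sets D_sets disj
    by (intro finite_measure_finite_Union) (auto simp: disjoint_family_on_def)
  also have "\<dots> = (\<Sum>t\<in>T. prob (E t)) * measure (density N (if b then f1 else f0)) B"
    by (simp add: cond sum_distrib_right)
  also have "(\<Sum>t\<in>T. prob (E t)) = prob (\<Union>t\<in>T. E t)"
    using finT E_sets disj by (intro finite_measure_finite_Union[symmetric]) auto
  finally show ?thesis using prob_theta[OF i] by (simp add: E_union)
qed

lemma mixture_measurable: "mixture_density \<pi> f0 f1 \<in> borel_measurable N"
  unfolding mixture_density_def[abs_def] using f0_measurable f1_measurable by measurable

lemma lfdr_measurable: "lfdr \<pi> f0 f1 \<in> borel_measurable N"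
  unfolding lfdr_def[abs_def] using mixture_measurable f0_measurable by measurable

lemma mixture_nonneg: "z \<in> space N \<Longrightarrow> 0 \<le> mixture_density \<pi> f0 f1 z"
  unfolding mixture_density_def using f0_nonneg f1_nonneg pi_range by simp

lemma lfdr_bounds:
  assumes "z \<in> space N"
  shows "0 \<le> lfdr \<pi> f0 f1 z" "lfdr \<pi> f0 f1 z \<le> 1"
proof -
  have nn: "0 \<le> (1 - \<pi>) * f0 z" "0 \<le> \<pi> * f1 z"
    using assms f0_nonneg[of z] f1_nonneg[of z] pi_range by simp_all
  show "0 \<le> lfdr \<pi> f0 f1 z" "lfdr \<pi> f0 f1 z \<le> 1"
    unfolding lfdr_def mixture_density_def using nn by (auto simp: divide_le_eq_1)
qed

lemma lfdr_times_mixture: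
  assumes "z \<in> space N"
  shows "mixture_density \<pi> f0 f1 z * lfdr \<pi> f0 f1 z = (1 - \<pi>) * f0 z"
proof (cases "mixture_density \<pi> f0 f1 z = 0")
  case True
  have "(1 - \<pi>) * f0 z \<ge> 0" "\<pi> * f1 z \<ge> 0"
    using assms f0_nonneg[of z] f1_nonneg[of z] pi_range by simp_all
  then have "(1 - \<pi>) * f0 z = 0" using True unfolding mixture_density_def by linarith
  then show ?thesis using True by simp
qed (simp add: lfdr_def)

lemma measure_density_real:
  assumes B: "B \<in> sets N"
  shows "measure (density N (if b then f1 else f0)) B = (\<integral>z\<in>B. (if b then f1 else f0) z \<partial>N)"
    and "set_integrable N B (if b then f1 else f0)"
proof -
  let ?f = "if b then f1 else f0"
  have nn: "\<And>z. z \<in> space N \<Longrightarrow> 0 \<le> ?f z" using f0_nonneg f1_nonneg by simp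
  interpret d: prob_space "density N ?f" using f0_prob f1_prob by simp
  have eq: "(\<integral>\<^sup>+z. ennreal (indicator B z *\<^sub>R ?f z) \<partial>N) = emeasure (density N ?f) B"
    using B f_measurable[of b]
    by (subst emeasure_density) (auto intro!: nn_integral_cong simp: indicator_def)
  show I: "set_integrable N B ?f"
    unfolding set_integrable_def
    using B f_measurable[of b] eq d.emeasure_finite[of B] nn
    by (intro integrableI_nonneg) (auto simp flip: top.not_eq_extremum intro!: AE_I2)
  show "measure (density N ?f) B = (\<integral>z\<in>B. ?f z \<partial>N)"
    unfolding set_lebesgue_integral_def measure_def eq[symmetric]
    using B f_measurable[of b] nn by (subst integral_eq_nn_integral) (auto intro!: AE_I2)
qed

lemma distr_Z:
  assumes i: "i \<in> {1..m}"
  shows "distr M N (Z i) = density N (mixture_density \<pi> f0 f1)"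
proof (rule measure_eqI)
  fix B assume "B \<in> sets (distr M N (Z i))"
  then have B: "B \<in> sets N" by simp
  have meas: "{\<omega> \<in> space M. \<theta> i \<omega> = b \<and> Z i \<omega> \<in> B} \<in> sets M" for b
  proof -
    have "{\<omega> \<in> space M. \<theta> i \<omega> = b \<and> Z i \<omega> \<in> B} =
        (\<theta> i -` {b} \<inter> space M) \<inter> (Z i -` B \<inter> space M)" by auto
    then show ?thesis
      using measurable_sets[OF theta_measurable[OF i], of "{b}"]
        measurable_sets[OF Z_measurable[OF i] B] by simp
  qed
  have "emeasure (distr M N (Z i)) B = prob (Z i -` B \<inter> space M)"
    using B Z_measurable[OF i] by (simp add: emeasure_distr emeasure_eq_measure)
  also have "Z i -` B \<inter> space M =
      {\<omega> \<in> space M. \<theta> i \<omega> = False \<and> Z i \<omega> \<in> B} \<union> {\<omega> \<in> space M. \<theta> i \<omega> = True \<and> Z i \<omega> \<in> B}" by auto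
  also have "prob \<dots> = prob {\<omega> \<in> space M. \<theta> i \<omega> = False \<and> Z i \<omega> \<in> B} +
      prob {\<omega> \<in> space M. \<theta> i \<omega> = True \<and> Z i \<omega> \<in> B}"
    by (intro finite_measure_Union meas) auto
  also have "\<dots> = (1 - \<pi>) * (\<integral>z\<in>B. f0 z \<partial>N) + \<pi> * (\<integral>z\<in>B. f1 z \<partial>N)"
    unfolding prob_theta_Z[OF i B]
    using measure_density_real(1)[OF B, of False] measure_density_real(1)[OF B, of True] by simp
  also have "\<dots> = (\<integral>z\<in>B. mixture_density \<pi> f0 f1 z \<partial>N)"
    unfolding mixture_density_def
    using measure_density_real(2)[OF B, of False] measure_density_real(2)[OF B, of True] by simp
  also have "ennreal \<dots> = emeasure (density N (mixture_density \<pi> f0 f1)) B"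
  proof -
    have I: "set_integrable N B (mixture_density \<pi> f0 f1)"
      unfolding mixture_density_def[abs_def]
      using measure_density_real(2)[OF B, of False] measure_density_real(2)[OF B, of True] by simp
    have "ennreal (\<integral>z\<in>B. mixture_density \<pi> f0 f1 z \<partial>N) =
        (\<integral>\<^sup>+z. ennreal (indicator B z *\<^sub>R mixture_density \<pi> f0 f1 z) \<partial>N)"
      unfolding set_lebesgue_integral_def
      using I mixture_nonneg unfolding set_integrable_def
      by (intro nn_integral_eq_integral[symmetric]) (auto intro!: AE_I2)
    also have "\<dots> = emeasure (density N (mixture_density \<pi> f0 f1)) B"
      using B mixture_measurable
      by (subst emeasure_density) (auto intro!: nn_integral_cong simp: indicator_def)
    finally show ?thesis .
  qed
  finally show "emeasure (distr M N (Z i)) B = emeasure (density N (mixture_density \<pi> f0 f1)) B" .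
qed simp

lemma lfdr_cond_prob:
  assumes i: "i \<in> {1..m}"
  shows "AE \<omega> in M. real_cond_exp M (vimage_algebra (space M) (Z i) N)
    (indicator {\<omega> \<in> space M. \<not> \<theta> i \<omega>}) \<omega> = lfdr \<pi> f0 f1 (Z i \<omega>)"
proof -
  let ?F = "vimage_algebra (space M) (Z i) N"
  let ?A = "{\<omega> \<in> space M. \<not> \<theta> i \<omega>}"
  have Zm [measurable]: "Z i \<in> M \<rightarrow>\<^sub>M N" by (rule Z_measurable[OF i])
  have Zs: "Z i \<in> space M \<rightarrow> space N" using Zm by (rule measurable_space[THEN funcsetI])
  have sub: "subalgebra M ?F"
    unfolding subalgebra_def using sets_vimage_algebra2[OF Zs] measurable_sets[OF Zm] by auto
  interpret finite_measure_subalgebra M ?F by unfold_locales (rule sub)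
  have "?A = \<theta> i -` {False} \<inter> space M" by auto
  then have A [measurable]: "?A \<in> sets M"
    using measurable_sets[OF theta_measurable[OF i], of "{False}"] by simp
  have lm [measurable]: "lfdr \<pi> f0 f1 \<in> borel_measurable N" by (rule lfdr_measurable)
  show ?thesis
  proof (rule real_cond_exp_charact)
    fix C assume "C \<in> sets ?F"
    then obtain B where B [measurable]: "B \<in> sets N" and C: "C = Z i -` B \<inter> space M"
      using sets_vimage_algebra2[OF Zs] by auto
    have Cs [measurable]: "C \<in> sets M" unfolding C by measurable
    have "(\<integral>\<omega>\<in>C. indicator ?A \<omega> \<partial>M) = (\<integral>\<omega>. indicator (C \<inter> ?A) \<omega> \<partial>M)"
      unfolding set_lebesgue_integral_def
      by (rule Bochner_Integration.integral_cong[OF refl]) (simp add: indicator_def)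
    also have "\<dots> = prob (C \<inter> ?A)" using A Cs by simp
    also have "C \<inter> ?A = {\<omega> \<in> space M. \<theta> i \<omega> = False \<and> Z i \<omega> \<in> B}" by (auto simp: C)
    also have "prob \<dots> = (1 - \<pi>) * (\<integral>z\<in>B. f0 z \<partial>N)"
      unfolding prob_theta_Z[OF i B] using measure_density_real(1)[OF B, of False] by simp
    also have "\<dots> = (\<integral>z. mixture_density \<pi> f0 f1 z * (indicator B z * lfdr \<pi> f0 f1 z) \<partial>N)"
      unfolding set_lebesgue_integral_def
      by (subst integral_mult_right_zero[symmetric], rule Bochner_Integration.integral_cong[OF refl])
        (use lfdr_times_mixture in \<open>simp add: ac_simps indicator_def\<close>)
    also have "\<dots> = (\<integral>z. indicator B z * lfdr \<pi> f0 f1 z \<partial>density N (mixture_density \<pi> f0 f1))"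
      using mixture_measurable mixture_nonneg B lm
      by (subst integral_density) (auto intro!: AE_I2)
    also have "\<dots> = (\<integral>\<omega>. indicator B (Z i \<omega>) * lfdr \<pi> f0 f1 (Z i \<omega>) \<partial>M)"
      unfolding distr_Z[OF i, symmetric] by (subst integral_distr[OF Zm]) auto
    also have "\<dots> = (\<integral>\<omega>\<in>C. lfdr \<pi> f0 f1 (Z i \<omega>) \<partial>M)"
      unfolding set_lebesgue_integral_def
      by (rule Bochner_Integration.integral_cong[OF refl]) (auto simp: C indicator_def)
    finally show "(\<integral>\<omega>\<in>C. indicator ?A \<omega> \<partial>M) = (\<integral>\<omega>\<in>C. lfdr \<pi> f0 f1 (Z i \<omega>) \<partial>M)" .
  next
    show "integrable M (indicator ?A :: 'w \<Rightarrow> real)" using A by (simp add: less_top[symmetric])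
    show "integrable M (\<lambda>\<omega>. lfdr \<pi> f0 f1 (Z i \<omega>))"
      using lfdr_bounds measurable_space[OF Zm] by (intro integrable_const_bound[of _ 1]) auto
    show "(\<lambda>\<omega>. lfdr \<pi> f0 f1 (Z i \<omega>)) \<in> borel_measurable ?F"
      by (rule measurable_compose[OF measurable_vimage_algebra1[OF Zs] lm])
  qed
qed

end

text \<open>An auxiliary randomization variable \<open>U\<close> with values in an arbitrary measurable space \<open>S\<close>.
  A constant \<open>U\<close> yields the non-randomized rules.\<close>

definition auxiliary_randomization ::
  "'w measure \<Rightarrow> 'z measure \<Rightarrow> nat \<Rightarrow> (nat \<Rightarrow> 'w \<Rightarrow> bool) \<Rightarrow> (nat \<Rightarrow> 'w \<Rightarrow> 'z) \<Rightarrow>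
    'u measure \<Rightarrow> ('w \<Rightarrow> 'u) \<Rightarrow> bool" where
  "auxiliary_randomization M N m \<theta> Z S U \<longleftrightarrow>
    U \<in> M \<rightarrow>\<^sub>M S \<and>
    prob_space.indep_set M
      {U -` A \<inter> space M | A. A \<in> sets S}
      {(\<lambda>\<omega>. (\<lambda>i\<in>{1..m}. \<theta> i \<omega>, \<lambda>i\<in>{1..m}. Z i \<omega>)) -` B \<inter> space M | B.
        B \<in> sets (PiM {1..m} (\<lambda>_. count_space UNIV) \<Otimes>\<^sub>M PiM {1..m} (\<lambda>_. N))}"

text \<open>A rule maps the data vector and the value of the randomization variable to the vector of
  decisions; \<open>True\<close> stands for rejection.\<close>

type_synonym ('z, 'u) rule = "(nat \<Rightarrow> 'z) \<Rightarrow> 'u \<Rightarrow> nat \<Rightarrow> bool"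

definition decision_rule :: "nat \<Rightarrow> 'z measure \<Rightarrow> 'u measure \<Rightarrow> ('z, 'u) rule \<Rightarrow> bool" where
  "decision_rule m N S \<delta> \<longleftrightarrow>
    (\<forall>i\<in>{1..m}. (\<lambda>(z, u). \<delta> z u i) \<in> PiM {1..m} (\<lambda>_. N) \<Otimes>\<^sub>M S \<rightarrow>\<^sub>M count_space UNIV)"

text \<open>\<open>\<sigma> j\<close> is the hypothesis ranked \<open>j\<close>-th.  Both the ranking (through the resolution of ties) and
  the number \<open>k\<close> of rejections may depend on \<open>z\<close> and \<open>u\<close>.\<close>

definition lfdr_thresholding_rule ::
  "nat \<Rightarrow> 'z measure \<Rightarrow> 'u measure \<Rightarrow> real \<Rightarrow> ('z \<Rightarrow> real) \<Rightarrow> ('z \<Rightarrow> real) \<Rightarrow> ('z, 'u) rule \<Rightarrow> bool"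
where
  "lfdr_thresholding_rule m N S \<pi> f0 f1 \<delta> \<longleftrightarrow>
    decision_rule m N S \<delta> \<and>
    (\<forall>z\<in>space (PiM {1..m} (\<lambda>_. N)). \<forall>u\<in>space S.
      \<exists>\<sigma> k. bij_betw \<sigma> {1..m} {1..m} \<and>
        mono_on {1..m} (\<lambda>j. lfdr \<pi> f0 f1 (z (\<sigma> j))) \<and>
        k \<le> m \<and>
        (\<forall>i\<in>{1..m}. \<delta> z u i \<longleftrightarrow> i \<in> \<sigma> ` {1..k}))"

definition false_discovery_proportion :: "nat \<Rightarrow> (nat \<Rightarrow> bool) \<Rightarrow> (nat \<Rightarrow> bool) \<Rightarrow> real" where
  "false_discovery_proportion m t d =
    (\<Sum>i=1..m. (1 - of_bool (t i)) * of_bool (d i)) / max (\<Sum>i=1..m. of_bool (d i)) 1"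

definition true_positives :: "nat \<Rightarrow> (nat \<Rightarrow> bool) \<Rightarrow> (nat \<Rightarrow> bool) \<Rightarrow> real" where
  "true_positives m t d = (\<Sum>i=1..m. of_bool (t i) * of_bool (d i))"

end

(* Let the new rule reject as many hypotheses as the given one, but those with the smallest lfdr.
   Given the data z, the states are independent and null with odds (1 - \<pi>) f0 (z i) to \<pi> f1 (z i).
   Exchanging a rejected hypothesis for one with a smaller lfdr therefore decreases stochastically
   the number of false rejections.  Since the number of rejections is unchanged, every
   increasing function of the number of false rejections decreases in expectation; this
   covers both the indicator of an exceedance by the false discovery proportion and the negative
   of the number of true positives. *)
theory Submission
  imports Defs
begin

text \<open>Conditioning on the data is never carried out. The law of the data is computed on each
  of the finitely many events that fix the set of nulls, where it has a product density including
  the prior. Taken together these densities give the posterior up to the marginal density, a common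
  factor that does not affect a comparison at fixed data. For the same reason odds are compared
  after cross-multiplication, so vanishing densities and the values 0 and 1 of \<pi> need no
  separate treatment there. The obstacle is that an exceedance by the false discovery proportion is
  not additive over hypotheses: comparing sums of lfdr values is not enough, and a whole
  distribution has to be compared. Exchanging one pair achieves this. With all other states fixed,
  the two rejection sets differ in effect only when exactly one of the two hypotheses is null, and
  the ordering of the odds compares just these two outcomes.\<close>

section \<open>Weighted sums over subsets and the exchange argument\<close>

lemma sum_Pow_insert:
  assumes "finite J" "i \<notin> J"
  shows "(\<Sum>A\<in>Pow (insert i J). g A) = (\<Sum>A\<in>Pow J. g A + g (insert i A))"
proof -
  have "inj_on (insert i) (Pow J)"
    using assms by (auto simp: inj_on_def)
  moreover have "Pow J \<inter> insert i ` Pow J = {}"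
    using assms by auto
  ultimately show ?thesis
    using assms by (simp add: Pow_insert sum.union_disjoint sum.reindex sum.distrib)
qed

text \<open>With \<open>a\<close> and \<open>b\<close> the weights of a null and of a non-null at
  each index, this is the unnormalised probability, under independent states, that the set of nulls
  is \<open>A\<close>.\<close>

definition subset_weight ::
  "'i set \<Rightarrow> ('i \<Rightarrow> 'r) \<Rightarrow> ('i \<Rightarrow> 'r) \<Rightarrow> 'i set \<Rightarrow> 'r::comm_semiring_1" where
  "subset_weight I a b A = (\<Prod>i\<in>I. if i \<in> A then a i else b i)"

lemma subset_weight_nonneg:
  fixes a b :: "'i \<Rightarrow> real"
  assumes "\<And>i. i \<in> I \<Longrightarrow> 0 \<le> a i" "\<And>i. i \<in> I \<Longrightarrow> 0 \<le> b i"
  shows "0 \<le> subset_weight I a b A"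
  using assms unfolding subset_weight_def by (intro prod_nonneg) auto

lemma subset_weight_insert:
  assumes "finite J" "i \<notin> J" "i \<notin> A"
  shows "subset_weight (insert i J) a b A = b i * subset_weight J a b A"
    and "subset_weight (insert i J) a b (insert i A) = a i * subset_weight J a b A"
proof -
  have "(\<Prod>k\<in>J. if k \<in> insert i A then a k else b k) = (\<Prod>k\<in>J. if k \<in> A then a k else b k)"
    using assms by (intro prod.cong) auto
  then show "subset_weight (insert i J) a b A = b i * subset_weight J a b A"
    and "subset_weight (insert i J) a b (insert i A) = a i * subset_weight J a b A"
    using assms by (auto simp: subset_weight_def)
qed

(* The weights a and b need not add up to 1 at an index: this is an expectation up to normalisation. *)
definition expected_loss ::
  "'i set \<Rightarrow> ('i \<Rightarrow> real) \<Rightarrow> ('i \<Rightarrow> real) \<Rightarrow> (nat \<Rightarrow> real) \<Rightarrow> 'i set \<Rightarrow> real" where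
  "expected_loss I a b H D = (\<Sum>A\<in>Pow I. H (card (A \<inter> D)) * subset_weight I a b A)"

lemma expected_loss_exchange:
  fixes a b :: "'i \<Rightarrow> real"
  assumes I: "finite I" "C \<subseteq> I" "i \<in> I" "j \<in> I" "i \<notin> C" "j \<notin> C" "i \<noteq> j"
    and H: "mono H"
    and nn: "\<And>i. i \<in> I \<Longrightarrow> 0 \<le> a i" "\<And>i. i \<in> I \<Longrightarrow> 0 \<le> b i"
    and le: "a j * b i \<le> a i * b j"
  shows "expected_loss I a b H (insert j C) \<le> expected_loss I a b H (insert i C)"
proof -
  define J where "J = I - {i, j}"
  have J: "finite J" "i \<notin> insert j J" "j \<notin> J" "I = insert i (insert j J)"
    using I by (auto simp: J_def)
  \<comment> \<open>Null sets are grouped by their trace outside \<open>i\<close> and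
    \<open>j\<close>, which leaves four cases for each \<open>A \<subseteq> J\<close>.\<close>
  have expand: "(\<Sum>A\<in>Pow I. g A) =
      (\<Sum>A\<in>Pow J. g A + g (insert i A) + (g (insert j A) + g (insert i (insert j A))))"
    for g :: "'i set \<Rightarrow> real"
    using J by (simp add: sum_Pow_insert del: insert_iff)
  show ?thesis
    unfolding expected_loss_def expand
  proof (rule sum_mono)
    fix A assume "A \<in> Pow J"
    then have A: "A \<subseteq> J" "i \<notin> A" "j \<notin> A" "finite A"
      using J by (auto intro: finite_subset)
    define n where "n = card (A \<inter> C)"
    define w where "w = subset_weight J a b A"
    have w: "0 \<le> w"
      unfolding w_def using nn J by (intro subset_weight_nonneg) auto
    have W: "subset_weight I a b A = b i * b j * w"
      "subset_weight I a b (insert i A) = a i * b j * w"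
      "subset_weight I a b (insert j A) = b i * a j * w"
      "subset_weight I a b (insert i (insert j A)) = a i * a j * w"
      unfolding w_def using J A I(7) by (simp_all add: subset_weight_insert mult.assoc)
    have D: "A \<inter> insert i C = A \<inter> C" "A \<inter> insert j C = A \<inter> C"
      "insert i A \<inter> insert i C = insert i (A \<inter> C)" "insert i A \<inter> insert j C = A \<inter> C"
      "insert j A \<inter> insert i C = A \<inter> C" "insert j A \<inter> insert j C = insert j (A \<inter> C)"
      "insert i (insert j A) \<inter> insert i C = insert i (A \<inter> C)"
      "insert i (insert j A) \<inter> insert j C = insert j (A \<inter> C)"
      using A I by auto
    have c: "card (insert i (A \<inter> C)) = Suc n" "card (insert j (A \<inter> C)) = Suc n"
      using A by (simp_all add: n_def)
    \<comment> \<open>If neither or both of \<open>i\<close> and \<open>j\<close> are null, the two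
      sides have equal terms. The two mixed cases contribute exactly this product to the difference
      of the sides.\<close>
    have "0 \<le> (H (Suc n) - H n) * ((a i * b j - a j * b i) * w)"
      using monoD[OF H, of n "Suc n"] le w by simp
    then show "H (card (A \<inter> insert j C)) * subset_weight I a b A +
        H (card (insert i A \<inter> insert j C)) * subset_weight I a b (insert i A) +
        (H (card (insert j A \<inter> insert j C)) * subset_weight I a b (insert j A) +
         H (card (insert i (insert j A) \<inter> insert j C)) * subset_weight I a b (insert i (insert j A)))
      \<le> H (card (A \<inter> insert i C)) * subset_weight I a b A +
        H (card (insert i A \<inter> insert i C)) * subset_weight I a b (insert i A) +
        (H (card (insert j A \<inter> insert i C)) * subset_weight I a b (insert j A) +
         H (card (insert i (insert j A) \<inter> insert i C)) * subset_weight I a b (insert i (insert j A)))"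
      unfolding W D c n_def[symmetric] by (simp add: algebra_simps)
  qed
qed

text \<open>Elements of \<open>D - D'\<close> are exchanged one at a time, in any order, for
  elements of \<open>D' - D\<close>. Each exchange only shrinks the two differences, so the
  hypothesis on pairs persists through the induction.\<close>

lemma expected_loss_le:
  fixes a b :: "'i \<Rightarrow> real"
  assumes I: "finite I" "D \<subseteq> I" "D' \<subseteq> I" and card: "card D = card D'"
    and H: "mono H"
    and nn: "\<And>i. i \<in> I \<Longrightarrow> 0 \<le> a i" "\<And>i. i \<in> I \<Longrightarrow> 0 \<le> b i"
    and le: "\<And>i j. i \<in> D - D' \<Longrightarrow> j \<in> D' - D \<Longrightarrow> a j * b i \<le> a i * b j"
  shows "expected_loss I a b H D' \<le> expected_loss I a b H D"
  using I(2) card le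
proof (induction "card (D - D')" arbitrary: D)
  case 0
  have "finite D" "finite D'" using 0 I by (auto intro: finite_subset)
  with 0 have "D = D'" by (intro card_subset_eq) auto
  then show ?case by simp
next
  case (Suc n)
  have fin: "finite D" "finite D'" using Suc.prems I by (auto intro: finite_subset)
  \<comment> \<open>Equal cardinalities guarantee a partner in \<open>D' - D\<close> for every
    element that is given up.\<close>
  have "card (D' - D) = card (D - D')"
    using card_Diff_subset_Int[of D' D] card_Diff_subset_Int[of D D'] fin Suc.prems(2)
    by (simp add: Int_commute)
  then have "D - D' \<noteq> {}" "D' - D \<noteq> {}"
    using Suc.hyps(2) by (metis card.empty nat.distinct(1))+
  then obtain i j where ij: "i \<in> D - D'" "j \<in> D' - D" by blast
  define C where "C = D - {i}"
  have D: "D = insert i C" and C: "i \<notin> C" "j \<notin> C" "i \<noteq> j" "C \<subseteq> I" "finite C"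
    using ij Suc.prems fin by (auto simp: C_def)
  have "expected_loss I a b H D' \<le> expected_loss I a b H (insert j C)"
  proof (rule Suc.hyps(1))
    have "insert j C - D' = (D - D') - {i}" using ij by (auto simp: C_def)
    then show "n = card (insert j C - D')" using Suc.hyps(2) ij by simp
    show "insert j C \<subseteq> I" using C ij I by auto
    show "card (insert j C) = card D'" using C Suc.prems(2) D by simp
    show "a l * b k \<le> a k * b l" if "k \<in> insert j C - D'" "l \<in> D' - insert j C" for k l
      using Suc.prems(3)[of k l] that ij by (auto simp: C_def)
  qed
  also have "\<dots> \<le> expected_loss I a b H (insert i C)"
    using I C ij Suc.prems H nn by (intro expected_loss_exchange) auto
  finally show ?case using D by simp
qed

section \<open>A ranking with ties broken by index\<close>

text \<open>Breaking ties by index makes the ranks distinct, and a count of comparisons is easily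
  seen to be measurable in the data. Each index counts itself, so ranks start at 1.\<close>

definition stable_rank :: "nat \<Rightarrow> (nat \<Rightarrow> 'a::linorder) \<Rightarrow> nat \<Rightarrow> nat" where
  "stable_rank m T i = card {j \<in> {1..m}. T j < T i \<or> (T j = T i \<and> j \<le> i)}"

lemma stable_rank_less:
  assumes "i \<in> {1..m}" "j \<in> {1..m}" and "T i < T j \<or> (T i = T j \<and> i < j)"
  shows "stable_rank m T i < stable_rank m T j"
  unfolding stable_rank_def
proof (rule psubset_card_mono)
  show "{k \<in> {1..m}. T k < T i \<or> (T k = T i \<and> k \<le> i)} \<subset>
      {k \<in> {1..m}. T k < T j \<or> (T k = T j \<and> k \<le> j)}"
  proof (rule psubsetI)
    have "j \<in> {k \<in> {1..m}. T k < T j \<or> (T k = T j \<and> k \<le> j)}"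
      "j \<notin> {k \<in> {1..m}. T k < T i \<or> (T k = T i \<and> k \<le> i)}" using assms by auto
    then show "{k \<in> {1..m}. T k < T i \<or> (T k = T i \<and> k \<le> i)} \<noteq>
      {k \<in> {1..m}. T k < T j \<or> (T k = T j \<and> k \<le> j)}" by blast
  qed (use assms in auto)
qed simp

text \<open>Distinct indices are strictly ordered by value and then index, hence have different
  ranks; an injection of a finite set into itself is onto.\<close>

lemma bij_betw_stable_rank: "bij_betw (stable_rank m T) {1..m} {1..m}"
proof -
  have "inj_on (stable_rank m T) {1..m}"
  proof (rule inj_onI, rule ccontr)
    fix i j assume ij: "i \<in> {1..m}" "j \<in> {1..m}" "stable_rank m T i = stable_rank m T j" "i \<noteq> j"
    then consider "T i < T j \<or> (T i = T j \<and> i < j)" | "T j < T i \<or> (T j = T i \<and> j < i)"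
      by (metis linorder_less_linear)
    then show False
      using stable_rank_less[of i m j T] stable_rank_less[of j m i T] ij by cases auto
  qed
  moreover have "stable_rank m T ` {1..m} \<subseteq> {1..m}"
  proof safe
    fix i assume i: "i \<in> {1..m}"
    let ?S = "{j \<in> {1..m}. T j < T i \<or> (T j = T i \<and> j \<le> i)}"
    have "card ?S \<le> card {1..m}" by (intro card_mono) auto
    moreover have "0 < card ?S" using i by (subst card_gt_0_iff) auto
    ultimately show "stable_rank m T i \<in> {1..m}" by (simp add: stable_rank_def)
  qed
  ultimately show ?thesis
    by (simp add: bij_betw_def endo_inj_surj)
qed

lemma le_if_stable_rank_le:
  assumes "i \<in> {1..m}" "j \<in> {1..m}" "stable_rank m T i \<le> stable_rank m T j"
  shows "T i \<le> T j"
  using stable_rank_less[of j m i T] assms by force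

text \<open>The inverse of the ranking lists the hypotheses in order, which is the form demanded by
  \<open>lfdr_thresholding_rule\<close>.\<close>

lemma stable_rank_ordering:
  assumes "k \<le> m"
  shows "\<exists>\<sigma>. bij_betw \<sigma> {1..m} {1..m} \<and> mono_on {1..m} (\<lambda>j. T (\<sigma> j)) \<and>
    (\<forall>i\<in>{1..m}. stable_rank m T i \<le> k \<longleftrightarrow> i \<in> \<sigma> ` {1..k})"
proof -
  let ?r = "stable_rank m T"
  define \<sigma> where "\<sigma> = inv_into {1..m} ?r"
  note r = bij_betw_stable_rank[of m T]
  have b: "bij_betw \<sigma> {1..m} {1..m}"
    unfolding \<sigma>_def by (rule bij_betw_inv_into[OF r])
  have r\<sigma>: "?r (\<sigma> j) = j" if "j \<in> {1..m}" for j
    unfolding \<sigma>_def using bij_betw_inv_into_right[OF r that] .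
  have \<sigma>r: "\<sigma> (?r i) = i" if "i \<in> {1..m}" for i
    unfolding \<sigma>_def using bij_betw_inv_into_left[OF r that] .
  have "mono_on {1..m} (\<lambda>j. T (\<sigma> j))"
  proof (rule mono_onI)
    fix j l assume jl: "j \<in> {1..m}" "l \<in> {1..m}" "j \<le> l"
    show "T (\<sigma> j) \<le> T (\<sigma> l)"
    proof (rule le_if_stable_rank_le)
      show "\<sigma> j \<in> {1..m}" "\<sigma> l \<in> {1..m}"
        using bij_betw_apply[OF b] jl by blast+
      show "?r (\<sigma> j) \<le> ?r (\<sigma> l)"
        using jl by (simp only: r\<sigma>)
    qed
  qed
  moreover have "?r i \<le> k \<longleftrightarrow> i \<in> \<sigma> ` {1..k}" if i: "i \<in> {1..m}" for i
  proof
    assume "?r i \<le> k"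
    moreover have "1 \<le> ?r i"
      using bij_betw_apply[OF r i] by (simp only: atLeastAtMost_iff)
    ultimately have "?r i \<in> {1..k}"
      by (simp only: atLeastAtMost_iff simp_thms)
    then have "\<sigma> (?r i) \<in> \<sigma> ` {1..k}"
      by (rule imageI)
    then show "i \<in> \<sigma> ` {1..k}"
      by (simp only: \<sigma>r[OF i])
  next
    assume "i \<in> \<sigma> ` {1..k}"
    then obtain l where l: "l \<in> {1..k}" "i = \<sigma> l" by blast
    \<comment> \<open>Here \<open>k \<le> m\<close> ensures that \<open>l\<close> is an actual
      rank.\<close>
    then have "?r i = l" using r\<sigma>[of l] assms by simp
    then show "?r i \<le> k" using l by simp
  qed
  ultimately show ?thesis using b by blast
qed

lemma card_stable_rank_le:
  assumes "k \<le> m"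
  shows "card {i \<in> {1..m}. stable_rank m T i \<le> k} = k"
proof -
  let ?r = "stable_rank m T"
  note r = bij_betw_stable_rank[of m T]
  have "?r ` {i \<in> {1..m}. ?r i \<le> k} = {l \<in> ?r ` {1..m}. l \<le> k}" by blast
  also have "\<dots> = {1..k}" using r assms by (auto simp: bij_betw_def)
  finally have "card {1..k} = card (?r ` {i \<in> {1..m}. ?r i \<le> k})" by simp
  also have "\<dots> = card {i \<in> {1..m}. ?r i \<le> k}"
    by (intro card_image inj_on_subset[OF bij_betw_imp_inj_on[OF r]]) auto
  finally show ?thesis by simp
qed

section \<open>The joint law of states, data and randomization\<close>

context two_group_model
begin

(* Otherwise simp turns {1..m} into {Suc 0..m}, and facts about obs and data no longer match. *)
declare One_nat_def [simp del]

abbreviation "obs \<equiv> PiM {1..m} (\<lambda>_. N)"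

abbreviation data :: "'w \<Rightarrow> nat \<Rightarrow> 'z" where
  "data \<omega> \<equiv> (\<lambda>i\<in>{1..m}. Z i \<omega>)"

definition nulls :: "'w \<Rightarrow> nat set" where
  "nulls \<omega> = {i \<in> {1..m}. \<not> \<theta> i \<omega>}"

text \<open>Indexing by the set of nulls instead of the state vector matches the summation over
  \<open>Pow I\<close> in \<open>expected_loss\<close>.\<close>

definition states :: "nat set \<Rightarrow> 'w set" where
  "states A = {\<omega> \<in> space M. \<forall>i\<in>{1..m}. \<theta> i \<omega> = (i \<notin> A)}"

text \<open>The prior probabilities are included, so the total mass is
  \<open>prob (states A)\<close>. As a function of \<open>A\<close> at fixed \<open>z\<close> it is
  the posterior of the set of nulls up to normalisation.\<close>

definition joint_density :: "nat set \<Rightarrow> (nat \<Rightarrow> 'z) \<Rightarrow> real" where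
  "joint_density A z = subset_weight {1..m} (\<lambda>i. (1 - \<pi>) * f0 (z i)) (\<lambda>i. \<pi> * f1 (z i)) A"

lemma theta_event: "i \<in> {1..m} \<Longrightarrow> {\<omega> \<in> space M. \<theta> i \<omega> = b} \<in> sets M"
proof -
  assume "i \<in> {1..m}"
  moreover have "{\<omega> \<in> space M. \<theta> i \<omega> = b} = \<theta> i -` {b} \<inter> space M" by auto
  ultimately show ?thesis using measurable_sets[OF theta_measurable, of i "{b}"] by simp
qed

lemma states_sets [measurable]: "states A \<in> sets M"
  unfolding states_def using theta_event by (intro sets.sets_Collect_finite_All) auto

lemma data_measurable [measurable]: "data \<in> M \<rightarrow>\<^sub>M obs"
  by (intro measurable_restrict Z_measurable)

lemma states_iff:
  "\<omega> \<in> space M \<Longrightarrow> A \<subseteq> {1..m} \<Longrightarrow> \<omega> \<in> states A \<longleftrightarrow> A = nulls \<omega>"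
  by (auto simp: states_def nulls_def)

lemma prob_states: "prob (states A) = (\<Prod>i\<in>{1..m}. if i \<in> A then 1 - \<pi> else \<pi>)"
\<comment> \<open>For \<open>m = 0\<close> an intersection over the indices would be
  \<open>UNIV\<close> instead of \<open>space M\<close>, and the product rule for independent events
  asks for a nonempty index set.\<close>
proof (cases "m = 0")
  case True
  then have "states A = space M" unfolding states_def by auto
  then show ?thesis using True by (simp add: prob_space)
next
  case False
  have "states A = (\<Inter>i\<in>{1..m}. \<theta> i -` {i \<notin> A} \<inter> space M)"
    using False by (auto simp: states_def)
  also have "prob \<dots> = (\<Prod>i\<in>{1..m}. prob (\<theta> i -` {i \<notin> A} \<inter> space M))"
    using False by (intro indep_varsD_finite[OF theta_indep]) auto
  also have "\<dots> = (\<Prod>i\<in>{1..m}. if i \<in> A then 1 - \<pi> else \<pi>)"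
  proof (rule prod.cong)
    fix i assume "i \<in> {1..m}"
    then show "prob (\<theta> i -` {i \<notin> A} \<inter> space M) = (if i \<in> A then 1 - \<pi> else \<pi>)"
      using prob_theta[of i "i \<notin> A"] by (simp add: vimage_def Int_def conj_commute)
  qed simp
  finally show ?thesis .
qed

text \<open>Under the uniform measure on \<open>states A\<close>, which is the conditional law, the
  observations are independent with known densities. Boxes suffice because they determine a measure
  on the product space.\<close>

lemma prob_states_data_box:
  assumes B: "\<And>i. i \<in> {1..m} \<Longrightarrow> B i \<in> sets N" and pos: "prob (states A) > 0"
  shows "prob (states A \<inter> (data -` Pi\<^sub>E {1..m} B \<inter> space M)) =
    prob (states A) * (\<Prod>i\<in>{1..m}. measure (density N (if i \<in> A then f0 else f1)) (B i))"
proof (cases "m = 0")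
  case True
  then have "states A = space M" "data -` Pi\<^sub>E {1..m} B = UNIV"
    unfolding states_def by (auto simp: restrict_def)
  then show ?thesis using True by (simp add: prob_space)
next
  case False
  let ?Q = "uniform_measure M (states A)"
  have st: "states A = {\<omega> \<in> space M. \<forall>j\<in>{1..m}. \<theta> j \<omega> = (\<lambda>i. i \<notin> A) j}"
    by (simp add: states_def)
  have eQ: "emeasure M (states A) \<noteq> 0" "emeasure M (states A) \<noteq> \<infinity>"
    using pos by (auto simp: emeasure_eq_measure)
  interpret Q: prob_space ?Q
    using eQ by (rule prob_space_uniform_measure)
  have indep: "Q.indep_vars (\<lambda>_. N) Z {1..m}"
    using Z_cond_indep[of "\<lambda>i. i \<notin> A"] pos unfolding st by blast
  have box: "data -` Pi\<^sub>E {1..m} B \<inter> space M = (\<Inter>i\<in>{1..m}. Z i -` B i \<inter> space M)"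
    using False by (auto simp: PiE_iff)
  have box_sets: "data -` Pi\<^sub>E {1..m} B \<inter> space M \<in> sets M"
    using B by (intro measurable_sets[OF data_measurable] sets_PiM_I_finite) auto
  have "measure ?Q (data -` Pi\<^sub>E {1..m} B \<inter> space M) =
      (\<Prod>i\<in>{1..m}. measure ?Q (Z i -` B i \<inter> space M))"
    unfolding box using Q.indep_varsD_finite[OF indep, of B] False B by simp
  also have "\<dots> = (\<Prod>i\<in>{1..m}. measure (density N (if i \<in> A then f0 else f1)) (B i))"
  proof (rule prod.cong)
    fix i assume i: "i \<in> {1..m}"
    have "distributed ?Q N (Z i) (if i \<notin> A then f1 else f0)"
      using Z_cond_density[of "\<lambda>i. i \<notin> A" i] pos i unfolding st by blast
    then have "distr ?Q N (Z i) = density N (if i \<in> A then f0 else f1)"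
      "Z i \<in> ?Q \<rightarrow>\<^sub>M N"
      unfolding distributed_def by (auto split: if_splits)
    then show "measure ?Q (Z i -` B i \<inter> space M) =
        measure (density N (if i \<in> A then f0 else f1)) (B i)"
      using measure_distr[of "Z i" ?Q N "B i"] B[OF i] by simp
  qed simp
  finally show ?thesis
    using measure_uniform_measure[OF eQ box_sets] pos by (simp add: field_simps)
qed

lemma emeasure_density_weight:
  "emeasure (density N (\<lambda>z. ennreal (c * (if b then f0 else f1) z))) B =
    ennreal (c * measure (density N (if b then f0 else f1)) B)"
  if "B \<in> sets N" "0 \<le> c"
proof -
  let ?f = "if b then f0 else f1"
  have [measurable]: "?f \<in> borel_measurable N"
    using f0_measurable f1_measurable by simp
  interpret d: prob_space "density N ?f"
    using f0_prob f1_prob by simp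
  have "emeasure (density N (\<lambda>z. ennreal (c * ?f z))) B =
      (\<integral>\<^sup>+z. ennreal c * (ennreal (?f z) * indicator B z) \<partial>N)"
    using that by (subst emeasure_density) (auto simp: ennreal_mult' mult.assoc)
  also have "\<dots> = ennreal c * emeasure (density N ?f) B"
    using that by (subst nn_integral_cmult) (auto simp: emeasure_density)
  finally show ?thesis
    using that by (simp add: d.emeasure_eq_measure ennreal_mult')
qed

lemma joint_density_nonneg: "z \<in> space obs \<Longrightarrow> 0 \<le> joint_density A z"
  unfolding joint_density_def using pi_range f0_nonneg f1_nonneg
  by (intro subset_weight_nonneg mult_nonneg_nonneg) (auto simp: space_PiM PiE_iff)

lemma joint_density_measurable [measurable]: "joint_density A \<in> borel_measurable obs"
proof -
  have [measurable]: "(\<lambda>z. if i \<in> A then (1 - \<pi>) * f0 (z i) else \<pi> * f1 (z i)) \<in> borel_measurable obs"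
    if "i \<in> {1..m}" for i
    using that f0_measurable f1_measurable by measurable
  show ?thesis
    unfolding joint_density_def[abs_def] subset_weight_def
    by (intro borel_measurable_prod) measurable
qed

lemma emeasure_density_states:
  "X \<in> sets M \<Longrightarrow> emeasure (density M (indicator (states A))) X = prob (states A \<inter> X)"
proof -
  assume X [measurable]: "X \<in> sets M"
  have "emeasure (density M (indicator (states A))) X = emeasure M (states A \<inter> X)"
    by (simp add: emeasure_density indicator_inter_arith[symmetric])
  then show ?thesis by (simp only: emeasure_eq_measure)
qed

text \<open>Both sides are identified with the product of the weighted coordinate laws. Restricting
  \<open>M\<close> to \<open>states A\<close>, without normalising, also covers states of
  probability zero.\<close>

lemma distr_data:
  "distr (density M (indicator (states A))) obs data = density obs (joint_density A)"
proof -
  \<comment> \<open>The share of coordinate \<open>i\<close>: its density times the prior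
    probability of its state, a finite measure with that probability as total mass.\<close>
  define w where "w i = (\<lambda>z. ennreal ((if i \<in> A then 1 - \<pi> else \<pi>) * (if i \<in> A then f0 else f1) z))" for i :: nat
  have w_meas [measurable]: "w i \<in> borel_measurable N" for i
    using f0_measurable f1_measurable unfolding w_def by (cases "i \<in> A") simp_all
  have w: "emeasure (density N (w i)) B = ennreal ((if i \<in> A then 1 - \<pi> else \<pi>) * measure (density N (if i \<in> A then f0 else f1)) B)"
    if "B \<in> sets N" for i B
    unfolding w_def using that pi_range by (intro emeasure_density_weight) auto
  interpret N: product_sigma_finite "\<lambda>_::nat. N"
    by unfold_locales
  have fin: "finite_measure (density N (w i))" for i
    by (rule finite_measureI) (simp add: w)
  interpret W: product_sigma_finite "\<lambda>i. density N (w i)"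
    using fin by (simp add: product_sigma_finite_def finite_measure_def)
  have sets_W: "sets (PiM {1..m} (\<lambda>i. density N (w i))) = sets obs"
    by (intro sets_PiM_cong) auto
  have "distr (density M (indicator (states A))) obs data = PiM {1..m} (\<lambda>i. density N (w i))"
  proof (rule W.PiM_eqI)
    fix B :: "nat \<Rightarrow> 'z set" assume "\<And>i. i \<in> {1..m} \<Longrightarrow> B i \<in> sets (density N (w i))"
    then have B: "\<And>i. i \<in> {1..m} \<Longrightarrow> B i \<in> sets N" by simp
    let ?X = "data -` Pi\<^sub>E {1..m} B \<inter> space M"
    have box: "Pi\<^sub>E {1..m} B \<in> sets obs"
      using B by (intro sets_PiM_I_finite) auto
    then have X [measurable]: "?X \<in> sets M"
      by (rule measurable_sets[OF data_measurable])
    have "prob (states A \<inter> ?X) = prob (states A) *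
        (\<Prod>i\<in>{1..m}. measure (density N (if i \<in> A then f0 else f1)) (B i))"
    proof (cases "prob (states A) > 0")
      case True
      show ?thesis by (rule prob_states_data_box[OF B True])
    next
      \<comment> \<open>The model makes no conditional statement about such a state, but both sides
        vanish.\<close>
      case False
      then have "prob (states A) = 0" using measure_nonneg[of M "states A"] by linarith
      moreover have "prob (states A \<inter> ?X) \<le> prob (states A)" by (intro finite_measure_mono) auto
      ultimately show ?thesis using measure_nonneg[of M "states A \<inter> ?X"] by simp
    qed
    also have "\<dots> = (\<Prod>i\<in>{1..m}. (if i \<in> A then 1 - \<pi> else \<pi>) * measure (density N (if i \<in> A then f0 else f1)) (B i))"
      by (simp only: prob_states prod.distrib)
    also have "ennreal \<dots> = (\<Prod>i\<in>{1..m}. emeasure (density N (w i)) (B i))"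
      using pi_range B by (subst prod_ennreal[symmetric]) (auto intro!: prod.cong mult_nonneg_nonneg simp: w)
    finally have "ennreal (prob (states A \<inter> ?X)) = (\<Prod>i\<in>{1..m}. emeasure (density N (w i)) (B i))" .
    moreover have "emeasure (distr (density M (indicator (states A))) obs data) (Pi\<^sub>E {1..m} B) =
        prob (states A \<inter> ?X)"
      using box X by (subst emeasure_distr) (simp_all add: emeasure_density_states)
    ultimately show "emeasure (distr (density M (indicator (states A))) obs data) (Pi\<^sub>E {1..m} B) =
      (\<Prod>i\<in>{1..m}. emeasure (density N (w i)) (B i))" by simp
  qed (simp_all add: sets_W)
  \<comment> \<open>Second half: a product of measures with densities has the product density. On
    boxes this is Tonelli for a product of functions of single coordinates.\<close>
  also have "\<dots> = density obs (joint_density A)"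
  proof (rule W.PiM_eqI[symmetric])
    fix B :: "nat \<Rightarrow> 'z set" assume "\<And>i. i \<in> {1..m} \<Longrightarrow> B i \<in> sets (density N (w i))"
    then have B: "\<And>i. i \<in> {1..m} \<Longrightarrow> B i \<in> sets N" by simp
    have box: "Pi\<^sub>E {1..m} B \<in> sets obs"
      using B by (intro sets_PiM_I_finite) auto
    have eq: "ennreal (joint_density A z) * indicator (Pi\<^sub>E {1..m} B) z =
        (\<Prod>i\<in>{1..m}. w i (z i) * indicator (B i) (z i))" if z: "z \<in> space obs" for z
    proof -
      have zN: "z i \<in> space N" if "i \<in> {1..m}" for i
        using z that by (auto simp: space_PiM)
      have "(\<Prod>i\<in>{1..m}. w i (z i)) =
          (\<Prod>i\<in>{1..m}. ennreal (if i \<in> A then (1 - \<pi>) * f0 (z i) else \<pi> * f1 (z i)))"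
        by (rule prod.cong) (simp_all add: w_def)
      also have "\<dots> = ennreal (joint_density A z)"
        unfolding joint_density_def subset_weight_def using pi_range f0_nonneg f1_nonneg zN
        by (intro prod_ennreal) simp
      finally have "(\<Prod>i\<in>{1..m}. w i (z i)) = ennreal (joint_density A z)" .
      moreover have "(\<Prod>i\<in>{1..m}. indicator (B i) (z i)) = (indicator (Pi\<^sub>E {1..m} B) z :: ennreal)"
      proof (cases "z \<in> Pi\<^sub>E {1..m} B")
        case True
        then have "(\<Prod>i\<in>{1..m}. indicator (B i) (z i)) = (\<Prod>i\<in>{1..m}. 1 :: ennreal)"
          by (intro prod.cong) (auto simp: PiE_iff)
        then show ?thesis using True by simp
      next
        case False
        \<comment> \<open>Membership in the box includes extensionality; as \<open>z\<close> is
          extensional, it can leave the box only through a coordinate.\<close>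
        moreover have "z \<in> extensional {1..m}" using z by (simp add: space_PiM PiE_iff)
        ultimately obtain i where "i \<in> {1..m}" "z i \<notin> B i" unfolding PiE_iff by blast
        then have "(\<Prod>i\<in>{1..m}. indicator (B i) (z i)) = (0 :: ennreal)"
          by (intro prod_zero) (auto intro!: bexI[of _ i])
        then show ?thesis using False by simp
      qed
      ultimately show ?thesis by (simp add: prod.distrib)
    qed
    have "emeasure (density obs (joint_density A)) (Pi\<^sub>E {1..m} B) =
        (\<integral>\<^sup>+z. (\<Prod>i\<in>{1..m}. w i (z i) * indicator (B i) (z i)) \<partial>obs)"
      using box by (subst emeasure_density) (auto intro!: nn_integral_cong simp: eq)
    also have "\<dots> = (\<Prod>i\<in>{1..m}. \<integral>\<^sup>+z. w i z * indicator (B i) z \<partial>N)"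
      using B by (intro N.product_nn_integral_prod) auto
    also have "\<dots> = (\<Prod>i\<in>{1..m}. emeasure (density N (w i)) (B i))"
      using B by (intro prod.cong) (auto simp: emeasure_density)
    finally show "emeasure (density obs (joint_density A)) (Pi\<^sub>E {1..m} B) =
      (\<Prod>i\<in>{1..m}. emeasure (density N (w i)) (B i))" .
  qed (simp_all add: sets_W)
  finally show ?thesis .
qed

text \<open>\<open>U\<close> is independent of states and data jointly, so it remains independent of
  the data after restriction to \<open>states A\<close>.\<close>

lemma distr_data_randomization:
  assumes aux: "auxiliary_randomization M N m \<theta> Z S U"
  shows "distr (density M (indicator (states A))) (obs \<Otimes>\<^sub>M S) (\<lambda>\<omega>. (data \<omega>, U \<omega>)) =
    density obs (joint_density A) \<Otimes>\<^sub>M distr M S U"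
proof (rule pair_measure_eqI[symmetric])
  have U [measurable]: "U \<in> M \<rightarrow>\<^sub>M S"
    using aux by (simp add: auxiliary_randomization_def)
  have "finite_measure (density M (indicator (states A)))"
    by (rule finite_measureI) (simp add: emeasure_density_states)
  then have "finite_measure (density obs (joint_density A))"
    unfolding distr_data[symmetric] by (rule finite_measure.finite_measure_distr) simp
  then show "sigma_finite_measure (density obs (joint_density A))"
    by (simp add: finite_measure_def)
  show "sigma_finite_measure (distr M S U)"
    using prob_space_distr[OF U] by (simp add: prob_space_def finite_measure_def)
  show "sets (density obs (joint_density A) \<Otimes>\<^sub>M distr M S U) =
      sets (distr (density M (indicator (states A))) (obs \<Otimes>\<^sub>M S) (\<lambda>\<omega>. (data \<omega>, U \<omega>)))"
    by (simp cong: sets_pair_measure_cong)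
  fix B C assume "B \<in> sets (density obs (joint_density A))" "C \<in> sets (distr M S U)"
  then have [measurable]: "B \<in> sets obs" "C \<in> sets S" by simp_all
  let ?T = "PiM {1..m} (\<lambda>_. count_space UNIV) :: (nat \<Rightarrow> bool) measure"
  \<comment> \<open>The only state vector compatible with \<open>states A\<close>; its singleton is
    measurable as a box of singletons.\<close>
  let ?t = "{restrict (\<lambda>i. i \<notin> A) {1..m}}"
  have "?t = (\<Pi>\<^sub>E i\<in>{1..m}. {i \<notin> A})"
    by (auto simp: PiE_iff extensional_def fun_eq_iff)
  also have "\<dots> \<in> sets ?T"
    by (intro sets_PiM_I_finite) auto
  finally have [measurable]: "?t \<in> sets ?T" .
  have eq: "(\<lambda>\<omega>. (\<lambda>i\<in>{1..m}. \<theta> i \<omega>, data \<omega>)) -` (?t \<times> B) \<inter> space M =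
      states A \<inter> (data -` B \<inter> space M)"
    by (auto simp: states_def fun_eq_iff restrict_def)
  have "prob ((U -` C \<inter> space M) \<inter> (states A \<inter> (data -` B \<inter> space M))) =
      prob (U -` C \<inter> space M) * prob (states A \<inter> (data -` B \<inter> space M))"
  proof (rule indep_setD)
    show "indep_set {U -` A \<inter> space M | A. A \<in> sets S}
      {(\<lambda>\<omega>. (\<lambda>i\<in>{1..m}. \<theta> i \<omega>, data \<omega>)) -` B \<inter> space M | B. B \<in> sets (?T \<Otimes>\<^sub>M obs)}"
      using aux by (simp add: auxiliary_randomization_def)
    show "U -` C \<inter> space M \<in> {U -` A \<inter> space M | A. A \<in> sets S}"
      using \<open>C \<in> sets S\<close> by blast
    have "?t \<times> B \<in> sets (?T \<Otimes>\<^sub>M obs)" by measurable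
    then show "states A \<inter> (data -` B \<inter> space M) \<in>
      {(\<lambda>\<omega>. (\<lambda>i\<in>{1..m}. \<theta> i \<omega>, data \<omega>)) -` B \<inter> space M | B. B \<in> sets (?T \<Otimes>\<^sub>M obs)}"
      using eq by blast
  qed
  moreover have "(U -` C \<inter> space M) \<inter> (states A \<inter> (data -` B \<inter> space M)) =
      states A \<inter> ((\<lambda>\<omega>. (data \<omega>, U \<omega>)) -` (B \<times> C) \<inter> space M)" by auto
  ultimately show "emeasure (density obs (joint_density A)) B * emeasure (distr M S U) C =
      emeasure (distr (density M (indicator (states A))) (obs \<Otimes>\<^sub>M S) (\<lambda>\<omega>. (data \<omega>, U \<omega>))) (B \<times> C)"
    unfolding distr_data[symmetric]
    by (simp add: emeasure_distr emeasure_density_states emeasure_eq_measure ennreal_mult' mult.commute)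
qed

lemma nn_integral_states:
  assumes aux: "auxiliary_randomization M N m \<theta> Z S U"
    and h [measurable]: "h \<in> borel_measurable (obs \<Otimes>\<^sub>M S)"
  shows "(\<integral>\<^sup>+\<omega>. indicator (states A) \<omega> * h (data \<omega>, U \<omega>) \<partial>M) =
    (\<integral>\<^sup>+x. ennreal (joint_density A (fst x)) * h x \<partial>(obs \<Otimes>\<^sub>M distr M S U))"
proof -
  have U [measurable]: "U \<in> M \<rightarrow>\<^sub>M S"
    using aux by (simp add: auxiliary_randomization_def)
  interpret Q: prob_space "distr M S U"
    by (rule prob_space_distr[OF U])
  have [measurable]: "h \<in> borel_measurable (density obs (joint_density A) \<Otimes>\<^sub>M distr M S U)"
    using h by (simp cong: measurable_cong_sets sets_pair_measure_cong)
  have [measurable]: "h \<in> borel_measurable (obs \<Otimes>\<^sub>M distr M S U)"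
    using h by (simp cong: measurable_cong_sets sets_pair_measure_cong)
  have "(\<integral>\<^sup>+\<omega>. indicator (states A) \<omega> * h (data \<omega>, U \<omega>) \<partial>M) =
      (\<integral>\<^sup>+\<omega>. h (data \<omega>, U \<omega>) \<partial>density M (indicator (states A)))"
    by (subst nn_integral_density) auto
  also have "\<dots> = (\<integral>\<^sup>+x. h x \<partial>distr (density M (indicator (states A))) (obs \<Otimes>\<^sub>M S) (\<lambda>\<omega>. (data \<omega>, U \<omega>)))"
    by (subst nn_integral_distr) auto
  also have "\<dots> = (\<integral>\<^sup>+x. h x \<partial>(density obs (joint_density A) \<Otimes>\<^sub>M distr M S U))"
    by (simp only: distr_data_randomization[OF aux])
  also have "\<dots> = (\<integral>\<^sup>+z. \<integral>\<^sup>+u. h (z, u) \<partial>distr M S U \<partial>density obs (joint_density A))"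
    by (subst Q.nn_integral_fst[symmetric]) auto
  also have "\<dots> = (\<integral>\<^sup>+z. ennreal (joint_density A z) * (\<integral>\<^sup>+u. h (z, u) \<partial>distr M S U) \<partial>obs)"
    by (subst nn_integral_density) auto
  also have "\<dots> = (\<integral>\<^sup>+z. (\<integral>\<^sup>+u. ennreal (joint_density A z) * h (z, u) \<partial>distr M S U) \<partial>obs)"
    by (intro nn_integral_cong nn_integral_cmult[symmetric]) auto
  also have "\<dots> = (\<integral>\<^sup>+x. ennreal (joint_density A (fst x)) * h x \<partial>(obs \<Otimes>\<^sub>M distr M S U))"
    by (subst Q.nn_integral_fst[symmetric]) auto
  finally show ?thesis .
qed

text \<open>The events \<open>states A\<close> partition the space, so a single term
  survives.\<close>

lemma nulls_decompose:
  assumes "\<omega> \<in> space M"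
  shows "(\<Sum>A\<in>Pow {1..m}. indicator (states A) \<omega> * h A) = (h (nulls \<omega>) :: 'r::semiring_1)"
proof -
  have "(\<Sum>A\<in>Pow {1..m}. indicator (states A) \<omega> * h A) =
      (\<Sum>A\<in>Pow {1..m}. if A = nulls \<omega> then h A else 0)"
    using states_iff[OF assms] by (intro sum.cong) (auto simp: indicator_def)
  also have "\<dots> = h (nulls \<omega>)"
    by (subst sum.delta) (auto simp: nulls_def)
  finally show ?thesis .
qed

text \<open>An integrated form of Bayes' formula: the sum on the right is the posterior mean of the
  loss given data and randomization, up to the marginal density.\<close>

lemma nn_integral_nulls:
  assumes aux: "auxiliary_randomization M N m \<theta> Z S U"
    and h: "\<And>A. A \<subseteq> {1..m} \<Longrightarrow> h A \<in> borel_measurable (obs \<Otimes>\<^sub>M S)"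
  shows "(\<integral>\<^sup>+\<omega>. h (nulls \<omega>) (data \<omega>, U \<omega>) \<partial>M) =
    (\<integral>\<^sup>+x. (\<Sum>A\<in>Pow {1..m}. ennreal (joint_density A (fst x)) * h A x) \<partial>(obs \<Otimes>\<^sub>M distr M S U))"
proof -
  have U [measurable]: "U \<in> M \<rightarrow>\<^sub>M S"
    using aux by (simp add: auxiliary_randomization_def)
  have hU: "h A \<in> borel_measurable (obs \<Otimes>\<^sub>M distr M S U)" if "A \<subseteq> {1..m}" for A
    using h[OF that] by (simp cong: measurable_cong_sets sets_pair_measure_cong)
  have hM: "(\<lambda>\<omega>. h A (data \<omega>, U \<omega>)) \<in> borel_measurable M" if "A \<subseteq> {1..m}" for A
    using h[OF that] by measurable
  have "(\<integral>\<^sup>+\<omega>. h (nulls \<omega>) (data \<omega>, U \<omega>) \<partial>M) =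
      (\<integral>\<^sup>+\<omega>. (\<Sum>A\<in>Pow {1..m}. indicator (states A) \<omega> * h A (data \<omega>, U \<omega>)) \<partial>M)"
    by (rule nn_integral_cong, rule sym, rule nulls_decompose)
  also have "\<dots> = (\<Sum>A\<in>Pow {1..m}. \<integral>\<^sup>+\<omega>. indicator (states A) \<omega> * h A (data \<omega>, U \<omega>) \<partial>M)"
    using hM by (intro nn_integral_sum) auto
  also have "\<dots> = (\<Sum>A\<in>Pow {1..m}. \<integral>\<^sup>+x. ennreal (joint_density A (fst x)) * h A x \<partial>(obs \<Otimes>\<^sub>M distr M S U))"
    using h by (intro sum.cong nn_integral_states[OF aux]) auto
  also have "\<dots> = (\<integral>\<^sup>+x. (\<Sum>A\<in>Pow {1..m}. ennreal (joint_density A (fst x)) * h A x) \<partial>(obs \<Otimes>\<^sub>M distr M S U))"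
    using hU by (intro nn_integral_sum[symmetric]) auto
  finally show ?thesis .
qed

section \<open>Comparison of risks at fixed data and after integration\<close>

text \<open>Writing null and alternative weights as mixture density times lfdr and times one minus
  lfdr, the mixed products cancel. Where a mixture density is zero both sides are zero, so the
  default value of the quotient in \<open>lfdr\<close> does no harm.\<close>

lemma lfdr_le_cross:
  assumes z: "y \<in> space N" "z \<in> space N" and le: "lfdr \<pi> f0 f1 y \<le> lfdr \<pi> f0 f1 z"
  shows "((1 - \<pi>) * f0 y) * (\<pi> * f1 z) \<le> ((1 - \<pi>) * f0 z) * (\<pi> * f1 y)"
proof -
  let ?f = "mixture_density \<pi> f0 f1" and ?T = "lfdr \<pi> f0 f1"
  have null: "(1 - \<pi>) * f0 x = ?f x * ?T x" if "x \<in> space N" for x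
    using lfdr_times_mixture[OF that] by simp
  have alt: "\<pi> * f1 x = ?f x * (1 - ?T x)" if "x \<in> space N" for x
    using null[OF that] unfolding mixture_density_def by (simp add: algebra_simps)
  have "0 \<le> ?f y * ?f z * (?T z - ?T y)"
    using mixture_nonneg z le by simp
  then show ?thesis
    unfolding null[OF z(1)] null[OF z(2)] alt[OF z(1)] alt[OF z(2)] by (simp add: algebra_simps)
qed

abbreviation rejected :: "('z, 'u) rule \<Rightarrow> (nat \<Rightarrow> 'z) \<Rightarrow> 'u \<Rightarrow> nat set" where
  "rejected \<delta> z u \<equiv> {i \<in> {1..m}. \<delta> z u i}"

lemma loss_measurable:
  assumes "decision_rule m N S \<delta>"
  shows "(\<lambda>(z, u). H (card (rejected \<delta> z u)) (card (A \<inter> rejected \<delta> z u)) :: real)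
    \<in> borel_measurable (obs \<Otimes>\<^sub>M S)"
proof -
  have dec: "{x \<in> space (obs \<Otimes>\<^sub>M S). i \<in> B \<inter> rejected \<delta> (fst x) (snd x)} \<in> sets (obs \<Otimes>\<^sub>M S)" for i B
  proof (cases "i \<in> B \<inter> {1..m}")
    case True
    then have "(\<lambda>(z, u). \<delta> z u i) \<in> obs \<Otimes>\<^sub>M S \<rightarrow>\<^sub>M count_space UNIV"
      using assms unfolding decision_rule_def by blast
    from measurable_sets[OF this, of "{True}"] show ?thesis
      using True by (simp add: vimage_def Int_def case_prod_beta conj_commute)
  next
    case False
    then have "{x \<in> space (obs \<Otimes>\<^sub>M S). i \<in> B \<inter> rejected \<delta> (fst x) (snd x)} = {}" by auto
    then show ?thesis by (simp only: sets.empty_sets)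
  qed
  have c: "(\<lambda>x. card (B \<inter> rejected \<delta> (fst x) (snd x))) \<in> obs \<Otimes>\<^sub>M S \<rightarrow>\<^sub>M count_space UNIV" for B
    by (rule measurable_card[where S = "\<lambda>x. B \<inter> rejected \<delta> (fst x) (snd x)"]) (rule dec)
  \<comment> \<open>Intersecting with \<open>UNIV\<close> lets \<open>c\<close> serve for both
    counts. As counts take countably many values, an arbitrary \<open>H\<close> preserves
    measurability.\<close>
  have "(\<lambda>x. H (card (UNIV \<inter> rejected \<delta> (fst x) (snd x))) (card (A \<inter> rejected \<delta> (fst x) (snd x))))
    \<in> borel_measurable (obs \<Otimes>\<^sub>M S)"
  proof (rule measurable_compose_countable[where g = "\<lambda>x. card (UNIV \<inter> rejected \<delta> (fst x) (snd x))"
        and f = "\<lambda>k x. H k (card (A \<inter> rejected \<delta> (fst x) (snd x)))", OF _ c])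
    fix k
    show "(\<lambda>x. H k (card (A \<inter> rejected \<delta> (fst x) (snd x)))) \<in> borel_measurable (obs \<Otimes>\<^sub>M S)"
      by (rule measurable_compose[where g = "H k", OF c]) simp
  qed
  then show ?thesis by (simp only: case_prod_unfold Int_UNIV_left)
qed

text \<open>The set of nulls is not a function of data and randomization, so measurability is
  obtained separately on each of the finitely many events \<open>states A\<close>.\<close>

lemma loss_measurable_M:
  assumes aux: "auxiliary_randomization M N m \<theta> Z S U" and "decision_rule m N S \<delta>"
  shows "(\<lambda>\<omega>. H (card (rejected \<delta> (data \<omega>) (U \<omega>))) (card (nulls \<omega> \<inter> rejected \<delta> (data \<omega>) (U \<omega>))) :: real)
    \<in> borel_measurable M"
proof -
  have U [measurable]: "U \<in> M \<rightarrow>\<^sub>M S"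
    using aux by (simp add: auxiliary_randomization_def)
  have [measurable]: "(\<lambda>\<omega>. H (card (rejected \<delta> (data \<omega>) (U \<omega>))) (card (A \<inter> rejected \<delta> (data \<omega>) (U \<omega>))))
    \<in> borel_measurable M" for A
  proof -
    have "(\<lambda>\<omega>. (data \<omega>, U \<omega>)) \<in> M \<rightarrow>\<^sub>M obs \<Otimes>\<^sub>M S" by measurable
    from measurable_compose[OF this loss_measurable[OF assms(2), of H A]] show ?thesis
      by (simp only: case_prod_conv)
  qed
  have "(\<lambda>\<omega>. \<Sum>A\<in>Pow {1..m}. indicator (states A) \<omega> *
      H (card (rejected \<delta> (data \<omega>) (U \<omega>))) (card (A \<inter> rejected \<delta> (data \<omega>) (U \<omega>))))
    \<in> borel_measurable M" by measurable
  then show ?thesis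
    by (rule measurable_cong[THEN iffD1, rotated]) (rule nulls_decompose)
qed

text \<open>In \<open>H k n\<close> the arguments count all rejections and false rejections.
  Monotonicity is required in \<open>n\<close> only, since the rules agree in \<open>k\<close>; thus
  a loss may depend on \<open>k\<close> in any way, as the false discovery proportion does through
  its denominator.\<close>

lemma risk_le:
  fixes H :: "nat \<Rightarrow> nat \<Rightarrow> real" and S :: "'u measure" and \<delta> \<delta>' :: "('z, 'u) rule"
  assumes aux: "auxiliary_randomization M N m \<theta> Z S U"
    and rules: "decision_rule m N S \<delta>" "decision_rule m N S \<delta>'"
    and card: "\<And>z u. z \<in> space obs \<Longrightarrow> u \<in> space S \<Longrightarrow>
      card (rejected \<delta>' z u) = card (rejected \<delta> z u)"
    and lfdr: "\<And>z u i j. z \<in> space obs \<Longrightarrow> u \<in> space S \<Longrightarrow>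
      i \<in> rejected \<delta> z u - rejected \<delta>' z u \<Longrightarrow> j \<in> rejected \<delta>' z u - rejected \<delta> z u \<Longrightarrow>
      lfdr \<pi> f0 f1 (z j) \<le> lfdr \<pi> f0 f1 (z i)"
    and H: "\<And>k. mono (H k)" "\<And>k n. 0 \<le> H k n" "\<And>k n. H k n \<le> c"
  shows "(\<integral>\<omega>. H (card (rejected \<delta>' (data \<omega>) (U \<omega>))) (card (nulls \<omega> \<inter> rejected \<delta>' (data \<omega>) (U \<omega>))) \<partial>M) \<le>
    (\<integral>\<omega>. H (card (rejected \<delta> (data \<omega>) (U \<omega>))) (card (nulls \<omega> \<inter> rejected \<delta> (data \<omega>) (U \<omega>))) \<partial>M)"
proof -
  define L where "L \<delta> A = (\<lambda>(z, u). ennreal (H (card (rejected \<delta> z u)) (card (A \<inter> rejected \<delta> z u))))"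
    for \<delta> :: "('z, 'u) rule" and A
  have L: "L \<delta> A \<in> borel_measurable (obs \<Otimes>\<^sub>M S)" if "decision_rule m N S \<delta>" for \<delta> A
    using loss_measurable[OF that, of H A] unfolding L_def case_prod_beta by measurable
  have sum_eq: "(\<Sum>A\<in>Pow {1..m}. ennreal (joint_density A z) * L \<delta> A (z, u)) =
      ennreal (expected_loss {1..m} (\<lambda>i. (1 - \<pi>) * f0 (z i)) (\<lambda>i. \<pi> * f1 (z i))
        (H (card (rejected \<delta> z u))) (rejected \<delta> z u))"
    if "z \<in> space obs" for \<delta> :: "('z, 'u) rule" and z u
    using joint_density_nonneg[OF that] H(2)
    unfolding expected_loss_def L_def joint_density_def[symmetric]
    by (subst sum_ennreal[symmetric]) (auto simp: ennreal_mult' mult.commute intro!: sum.cong)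
  have nn: "(\<integral>\<^sup>+\<omega>. L \<delta>' (nulls \<omega>) (data \<omega>, U \<omega>) \<partial>M) \<le> (\<integral>\<^sup>+\<omega>. L \<delta> (nulls \<omega>) (data \<omega>, U \<omega>) \<partial>M)"
    unfolding nn_integral_nulls[OF aux, where h = "L \<delta>", OF L[OF rules(1)]]
      nn_integral_nulls[OF aux, where h = "L \<delta>'", OF L[OF rules(2)]]
  \<comment> \<open>The comparison already holds pointwise in data and randomization, before any
    integration.\<close>
  proof (rule nn_integral_mono)
    fix x assume "x \<in> space (obs \<Otimes>\<^sub>M distr M S U)"
    then obtain z u where x: "x = (z, u)" and zu: "z \<in> space obs" "u \<in> space S"
      by (auto simp: space_pair_measure)
    have zN: "z i \<in> space N" if "i \<in> {1..m}" for i
      using zu(1) that by (auto simp: space_PiM)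
    have "expected_loss {1..m} (\<lambda>i. (1 - \<pi>) * f0 (z i)) (\<lambda>i. \<pi> * f1 (z i))
        (H (card (rejected \<delta> z u))) (rejected \<delta>' z u) \<le>
      expected_loss {1..m} (\<lambda>i. (1 - \<pi>) * f0 (z i)) (\<lambda>i. \<pi> * f1 (z i))
        (H (card (rejected \<delta> z u))) (rejected \<delta> z u)"
    proof (rule expected_loss_le)
      fix i j assume "i \<in> rejected \<delta> z u - rejected \<delta>' z u" "j \<in> rejected \<delta>' z u - rejected \<delta> z u"
      then show "((1 - \<pi>) * f0 (z j)) * (\<pi> * f1 (z i)) \<le> ((1 - \<pi>) * f0 (z i)) * (\<pi> * f1 (z j))"
        using lfdr[OF zu] zN by (intro lfdr_le_cross) auto
    qed (use card[OF zu] H(1) zN f0_nonneg f1_nonneg pi_range in auto)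
    then show "(\<Sum>A\<in>Pow {1..m}. ennreal (joint_density A (fst x)) * L \<delta>' A x) \<le>
        (\<Sum>A\<in>Pow {1..m}. ennreal (joint_density A (fst x)) * L \<delta> A x)"
      unfolding x fst_conv sum_eq[OF zu(1)] card[OF zu] by (rule ennreal_leI)
  qed
  have int: "ennreal (\<integral>\<omega>. H (card (rejected \<delta> (data \<omega>) (U \<omega>))) (card (nulls \<omega> \<inter> rejected \<delta> (data \<omega>) (U \<omega>))) \<partial>M) =
      (\<integral>\<^sup>+\<omega>. L \<delta> (nulls \<omega>) (data \<omega>, U \<omega>) \<partial>M)"
    if rule: "decision_rule m N S \<delta>" for \<delta> :: "('z, 'u) rule"
  proof -
    let ?R = "\<lambda>\<omega>. H (card (rejected \<delta> (data \<omega>) (U \<omega>))) (card (nulls \<omega> \<inter> rejected \<delta> (data \<omega>) (U \<omega>)))"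
    \<comment> \<open>The bound \<open>c\<close> gives integrability, so the inequality between
      nonnegative integrals passes to Bochner integrals.\<close>
    have "integrable M ?R"
      by (rule integrable_const_bound[where B = c, OF _ loss_measurable_M[OF aux rule, of H]])
        (simp add: H)
    then show ?thesis
      unfolding L_def case_prod_conv by (rule nn_integral_eq_integral[symmetric]) (simp add: H)
  qed
  show ?thesis
    using nn unfolding int[OF rules(1), symmetric] int[OF rules(2), symmetric]
    by (rule ennreal_le_iff[THEN iffD1, rotated]) (simp add: H integral_nonneg_AE)
qed

text \<open>The rank counts indices satisfying measurable comparisons of lfdr values, and the cutoff
  is a measurable count of rejections.\<close>

lemma decision_rule_rank:
  assumes "decision_rule m N S \<delta>"
  shows "decision_rule m N S
    (\<lambda>z u i. stable_rank m (\<lambda>i. lfdr \<pi> f0 f1 (z i)) i \<le> card (rejected \<delta> z u))"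
  unfolding decision_rule_def
proof
  fix i assume i: "i \<in> {1..m}"
  have [measurable]: "(\<lambda>x. lfdr \<pi> f0 f1 (fst x j)) \<in> borel_measurable (obs \<Otimes>\<^sub>M S)" if "j \<in> {1..m}" for j
    using lfdr_measurable that by measurable
  have less: "{x \<in> space (obs \<Otimes>\<^sub>M S).
      j \<in> {j \<in> {1..m}. lfdr \<pi> f0 f1 (fst x j) < lfdr \<pi> f0 f1 (fst x i) \<or>
        (lfdr \<pi> f0 f1 (fst x j) = lfdr \<pi> f0 f1 (fst x i) \<and> j \<le> i)}} \<in> sets (obs \<Otimes>\<^sub>M S)" for j
    using i by (cases "j \<in> {1..m}") simp_all
  have "(\<lambda>x. stable_rank m (\<lambda>i. lfdr \<pi> f0 f1 (fst x i)) i) \<in> obs \<Otimes>\<^sub>M S \<rightarrow>\<^sub>M count_space UNIV"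
    unfolding stable_rank_def by (rule measurable_card) (rule less)
  then have [measurable]: "(\<lambda>x. real (stable_rank m (\<lambda>i. lfdr \<pi> f0 f1 (fst x i)) i)) \<in> borel_measurable (obs \<Otimes>\<^sub>M S)"
    by measurable
  have [measurable]: "(\<lambda>x. real (card (rejected \<delta> (fst x) (snd x)))) \<in> borel_measurable (obs \<Otimes>\<^sub>M S)"
    using loss_measurable[OF assms, of "\<lambda>k n. real k" "{}"] by (simp only: case_prod_unfold)
  have "(\<lambda>x. real (stable_rank m (\<lambda>i. lfdr \<pi> f0 f1 (fst x i)) i) \<le> real (card (rejected \<delta> (fst x) (snd x))))
    \<in> obs \<Otimes>\<^sub>M S \<rightarrow>\<^sub>M count_space UNIV"
    by measurable
  then show "(\<lambda>(z, u). stable_rank m (\<lambda>i. lfdr \<pi> f0 f1 (z i)) i \<le> card (rejected \<delta> z u))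
    \<in> obs \<Otimes>\<^sub>M S \<rightarrow>\<^sub>M count_space UNIV"
    by (simp only: case_prod_unfold of_nat_le_iff)
qed

section \<open>Both criteria in terms of the two counts, and the theorem\<close>

lemma false_discovery_proportion_eq:
  "false_discovery_proportion m (\<lambda>i. \<theta> i \<omega>) d =
    real (card (nulls \<omega> \<inter> {i \<in> {1..m}. d i})) / max (real (card {i \<in> {1..m}. d i})) 1"
proof -
  have "(\<Sum>i=1..m. (1 - of_bool (\<theta> i \<omega>)) * of_bool (d i)) =
      (\<Sum>i=1..m. of_bool (\<not> \<theta> i \<omega> \<and> d i) :: real)"
    by (rule sum.cong) auto
  also have "\<dots> = real (card (nulls \<omega> \<inter> {i \<in> {1..m}. d i}))"
    by (simp add: sum_of_bool_eq nulls_def) (auto intro!: arg_cong[where f = card])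
  finally show ?thesis
    by (simp add: false_discovery_proportion_def sum_of_bool_eq Int_def)
qed

lemma true_positives_eq:
  "true_positives m (\<lambda>i. \<theta> i \<omega>) d =
    real (card {i \<in> {1..m}. d i}) - real (card (nulls \<omega> \<inter> {i \<in> {1..m}. d i}))"
proof -
  let ?D = "{i \<in> {1..m}. d i}"
  have "true_positives m (\<lambda>i. \<theta> i \<omega>) d = (\<Sum>i=1..m. of_bool (\<theta> i \<omega> \<and> d i) :: real)"
    unfolding true_positives_def by (rule sum.cong) auto
  also have "\<dots> = real (card (?D - nulls \<omega> \<inter> ?D))"
    by (simp add: sum_of_bool_eq nulls_def) (auto intro!: arg_cong[where f = card])
  also have "\<dots> = real (card ?D) - real (card (nulls \<omega> \<inter> ?D))"
    by (simp add: card_Diff_subset of_nat_diff card_mono)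
  finally show ?thesis .
qed

end

theorem proposition2:
  fixes M :: "'w measure" and N :: "'z measure" and S :: "'u measure"
    and m :: nat and \<pi> \<gamma> \<alpha> :: real and f0 f1 :: "'z \<Rightarrow> real"
    and \<theta> :: "nat \<Rightarrow> 'w \<Rightarrow> bool" and Z :: "nat \<Rightarrow> 'w \<Rightarrow> 'z" and U :: "'w \<Rightarrow> 'u"
    and \<delta> :: "('z, 'u) rule"
  assumes "0 < \<gamma>" "\<gamma> < 1" "0 < \<alpha>" "\<alpha> < 1"
    and "two_group_model M N m \<pi> f0 f1 \<theta> Z"
    and "auxiliary_randomization M N m \<theta> Z S U"
    and "decision_rule m N S \<delta>"
    and "measure M {\<omega> \<in> space M. false_discovery_proportion m (\<lambda>i. \<theta> i \<omega>)
      (\<delta> (\<lambda>i\<in>{1..m}. Z i \<omega>) (U \<omega>)) > \<gamma>} \<le> \<alpha>"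
  shows "\<exists>\<delta>' :: ('z, 'u) rule.
    lfdr_thresholding_rule m N S \<pi> f0 f1 \<delta>' \<and>
    measure M {\<omega> \<in> space M. false_discovery_proportion m (\<lambda>i. \<theta> i \<omega>)
      (\<delta>' (\<lambda>i\<in>{1..m}. Z i \<omega>) (U \<omega>)) > \<gamma>} \<le> \<alpha> \<and>
    (\<integral>\<omega>. true_positives m (\<lambda>i. \<theta> i \<omega>) (\<delta>' (\<lambda>i\<in>{1..m}. Z i \<omega>) (U \<omega>)) \<partial>M) \<ge>
    (\<integral>\<omega>. true_positives m (\<lambda>i. \<theta> i \<omega>) (\<delta> (\<lambda>i\<in>{1..m}. Z i \<omega>) (U \<omega>)) \<partial>M)"
proof -
  interpret two_group_model M N m \<pi> f0 f1 \<theta> Z by fact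
  note aux = assms(6) and rule = assms(7)
  define T where "T z = (\<lambda>i. lfdr \<pi> f0 f1 (z i))" for z :: "nat \<Rightarrow> 'z"
  \<comment> \<open>The cutoff is recomputed from the given rule at the same \<open>z\<close> and
    the same \<open>u\<close>, so no further randomization enters.\<close>
  define \<delta>' :: "('z, 'u) rule" where
    "\<delta>' = (\<lambda>z u i. stable_rank m (T z) i \<le> card (rejected \<delta> z u))"
  have k: "card (rejected \<delta> z u) \<le> m" for \<delta> :: "('z, 'u) rule" and z u
  proof -
    have "card (rejected \<delta> z u) \<le> card {1..m}" by (rule card_mono) auto
    then show ?thesis by simp
  qed
  have rule': "decision_rule m N S \<delta>'"
    unfolding \<delta>'_def T_def by (rule decision_rule_rank[OF rule])
  have card': "card (rejected \<delta>' z u) = card (rejected \<delta> z u)" for z u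
    unfolding \<delta>'_def by (rule card_stable_rank_le[OF k])
  have lfdr: "lfdr \<pi> f0 f1 (z j) \<le> lfdr \<pi> f0 f1 (z i)"
    if "i \<in> rejected \<delta> z u - rejected \<delta>' z u" "j \<in> rejected \<delta>' z u - rejected \<delta> z u" for z u i j
    using that le_if_stable_rank_le[of j m i "T z"] by (auto simp: \<delta>'_def T_def)
  have risk: "(\<integral>\<omega>. H (card (rejected \<delta>' (data \<omega>) (U \<omega>))) (card (nulls \<omega> \<inter> rejected \<delta>' (data \<omega>) (U \<omega>))) \<partial>M) \<le>
      (\<integral>\<omega>. H (card (rejected \<delta> (data \<omega>) (U \<omega>))) (card (nulls \<omega> \<inter> rejected \<delta> (data \<omega>) (U \<omega>))) \<partial>M)"
    if "\<And>k. mono (H k)" "\<And>k n. 0 \<le> H k n" "\<And>k n. H k n \<le> c" for H :: "nat \<Rightarrow> nat \<Rightarrow> real" and c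
    by (rule risk_le[OF aux rule rule' card' lfdr that])

  have "lfdr_thresholding_rule m N S \<pi> f0 f1 \<delta>'"
    unfolding lfdr_thresholding_rule_def
  proof (intro conjI ballI rule')
    fix z u
    show "\<exists>\<sigma> k. bij_betw \<sigma> {1..m} {1..m} \<and> mono_on {1..m} (\<lambda>j. lfdr \<pi> f0 f1 (z (\<sigma> j))) \<and>
        k \<le> m \<and> (\<forall>i\<in>{1..m}. \<delta>' z u i \<longleftrightarrow> i \<in> \<sigma> ` {1..k})"
      using stable_rank_ordering[OF k[of \<delta> z u], of "T z"] k[of \<delta> z u]
      unfolding \<delta>'_def T_def by blast
  qed
  moreover have "prob {\<omega> \<in> space M. false_discovery_proportion m (\<lambda>i. \<theta> i \<omega>) (\<delta>' (data \<omega>) (U \<omega>)) > \<gamma>} \<le> \<alpha>"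
  proof -
    define H where "H k n = (of_bool (\<gamma> < real n / max (real k) 1) :: real)" for k n
    have FDP: "prob {\<omega> \<in> space M. false_discovery_proportion m (\<lambda>i. \<theta> i \<omega>) (\<delta> (data \<omega>) (U \<omega>)) > \<gamma>} =
        (\<integral>\<omega>. H (card (rejected \<delta> (data \<omega>) (U \<omega>))) (card (nulls \<omega> \<inter> rejected \<delta> (data \<omega>) (U \<omega>))) \<partial>M)"
      (is "prob ?A = _") for \<delta> :: "('z, 'u) rule"
    proof -
      have "prob ?A = (\<integral>\<omega>. indicator ?A \<omega> \<partial>M)" by (simp add: Int_absorb2)
      also have "\<dots> = (\<integral>\<omega>. H (card (rejected \<delta> (data \<omega>) (U \<omega>))) (card (nulls \<omega> \<inter> rejected \<delta> (data \<omega>) (U \<omega>))) \<partial>M)"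
        by (rule Bochner_Integration.integral_cong[OF refl])
          (simp add: H_def false_discovery_proportion_eq indicator_def)
      finally show ?thesis .
    qed
    have "mono (H k)" for k
    proof (rule monoI)
      fix n n' :: nat assume "n \<le> n'"
      \<comment> \<open>At fixed \<open>k\<close> the denominator is constant and positive.\<close>
      then have "real n / max (real k) 1 \<le> real n' / max (real k) 1"
        by (intro divide_right_mono) auto
      then show "H k n \<le> H k n'" by (simp add: H_def)
    qed
    then show ?thesis
      using risk[of H 1] assms(8) unfolding FDP by (simp add: H_def)
  qed
  moreover have "(\<integral>\<omega>. true_positives m (\<lambda>i. \<theta> i \<omega>) (\<delta> (data \<omega>) (U \<omega>)) \<partial>M) \<le>
      (\<integral>\<omega>. true_positives m (\<lambda>i. \<theta> i \<omega>) (\<delta>' (data \<omega>) (U \<omega>)) \<partial>M)"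
  proof -
    (* For n \<le> k \<le> m this is m minus the number k - n of true positives; the minimum only makes H bounded. *)
    define H where "H k n = real (min m (m + n - k))" for k n
    have TP: "(\<integral>\<omega>. true_positives m (\<lambda>i. \<theta> i \<omega>) (\<delta> (data \<omega>) (U \<omega>)) \<partial>M) = real m -
        (\<integral>\<omega>. H (card (rejected \<delta> (data \<omega>) (U \<omega>))) (card (nulls \<omega> \<inter> rejected \<delta> (data \<omega>) (U \<omega>))) \<partial>M)"
      if "decision_rule m N S \<delta>" for \<delta> :: "('z, 'u) rule"
    proof -
      let ?R = "\<lambda>\<omega>. H (card (rejected \<delta> (data \<omega>) (U \<omega>))) (card (nulls \<omega> \<inter> rejected \<delta> (data \<omega>) (U \<omega>)))"
      have "true_positives m (\<lambda>i. \<theta> i \<omega>) (\<delta> (data \<omega>) (U \<omega>)) = real m - ?R \<omega>" for \<omega>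
      proof -
        \<comment> \<open>Together with the bound \<open>k\<close> by \<open>m\<close>, this makes
          the natural-number subtraction in \<open>H\<close> exact and the minimum equal to its
          second argument.\<close>
        have "card (nulls \<omega> \<inter> rejected \<delta> (data \<omega>) (U \<omega>)) \<le> card (rejected \<delta> (data \<omega>) (U \<omega>))"
          by (intro card_mono) auto
        then show ?thesis
          unfolding true_positives_eq H_def using k[of \<delta> "data \<omega>" "U \<omega>"] by linarith
      qed
      moreover have "integrable M ?R"
        by (rule integrable_const_bound[where B = "real m", OF _ loss_measurable_M[OF aux that, of H]])
          (simp add: H_def)
      ultimately show ?thesis by (simp add: prob_space)
    qed
    have mono: "mono (H k)" for k
      unfolding mono_def H_def of_nat_le_iff by (intro allI impI min.mono diff_le_mono add_left_mono order_refl)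
    have "0 \<le> H k n" "H k n \<le> real m" for k n
      by (simp_all add: H_def)
    from risk[of H, OF mono this] show ?thesis
      unfolding TP[OF rule] TP[OF rule'] by linarith
  qed
  ultimately show ?thesis
    by (intro exI[of _ \<delta>'] conjI)
qed

end
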